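(* Let $x_0\in(0,q)$ be the optimal price level of the problem $V(x)=\sup_{\tau\ge0}E_x[e^{-r\tau}(q-X_\tau)^+I_{\{\tau<\tau_d\}}]$, $x\in(0,d)$, determined by $$\frac{(h'\psi-h\psi')(x_0)}{F(d)}=(h'\varphi-h\varphi')(x_0).$$ Then, varying one parameter at a time, $x_0$ is decreasing with respect to $d$, and increasing with respect to $r$ and with respect to $q$ (monotonicity in the weak sense).
   Context: Let $\mathcal I=(0,+\infty)$ and let $r>0$ be a constant. On a complete probability space with filtration $(\mathcal F_t)_{t\ge0}$ and an adapted standard one-dimensional Brownian motion $B$, the process $X$ with state space $\mathcal I$ satisfies $dX_t=\mu(X_t)dt+\sigma(X_t)dB_t$, $X_0=x\in\mathcal I$; $E_x=E[\cdot\mid X_0=x]$. Standing assumptions (for all parameter values considered): (i) $\mu:\mathcal I\to\mathbb R$ and $\sigma:\mathcal I\to(0,+\infty)$ are measurable and the SDE has a unique strong solution; (ii) $\theta(x)=rx-\mu(x)$ is non-decreasing on $\mathcal I$; (iii) $X$ is regular in $\mathcal I$ (every point of $\mathcal I$ is reached from every other with positive probability) and $0$ is a natural boundary. Let $\mathcal L=\frac12\sigma^2(x)\frac{d^2}{dx^2}+\mu(x)\frac{d}{dx}$. $\psi$ (resp. $\varphi$) denotes the positive strictly increasing (resp. strictly decreasing) $C^2$ solution, determined up to a positive factor, of $(\mathcal L-r)u=0$ on $\mathcal I$ such that, with $\tau_\kappa=\inf\{t\ge0:X_t=\kappa\}$, $E_x[e^{-r\tau_\kappa}]=\psi(x)/\psi(\kappa)$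 for $x\le\kappa$ and $E_x[e^{-r\tau_\kappa}]=\varphi(x)/\varphi(\kappa)$ for $x\ge\kappa$. In this setting $\psi(0+)=0$, $\varphi(0+)=+\infty$, $\varphi(+\infty)=0$, and $F=\psi/\varphi$ is a strictly increasing bijection of $\mathcal I$ onto $(0,+\infty)$. It is further assumed that $\varphi$ is convex on $(0,+\infty)$. $d>q>0$ are constants (barrier and strike), $\tau_d=\inf\{t\ge0:X_t=d\}$, $h(x)=(q-x)^+$, and suprema are over $(\mathcal F_t)$-stopping times. The stopping region $\{x\in(0,d):V(x)=h(x)\}$ is $(0,x_0]$. *)

theory Defs
  imports "HOL-Probability.Probability"
begin

text \<open>
  Time conventions.  Filtrations are indexed by \<open>[0, \<infinity>]\<close> (type \<^typ>\<open>ennreal\<close>), so that the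
  library's \<^const>\<open>stopping_time\<close> covers stopping times with values in \<open>[0, \<infinity>]\<close>; the condition
  it imposes at \<open>t = \<infinity>\<close> is void.  Processes are indexed by \<^typ>\<open>real\<close> and only
  their values at times \<open>t \<ge> 0\<close> matter.
\<close>

definition adapted :: "(ennreal \<Rightarrow> 'w measure) \<Rightarrow> (real \<Rightarrow> 'w \<Rightarrow> real) \<Rightarrow> bool" where
  "adapted F Y \<longleftrightarrow> (\<forall>t\<ge>0. Y t \<in> borel_measurable (F (ennreal t)))"

definition continuous_paths :: "'w measure \<Rightarrow> (real \<Rightarrow> 'w \<Rightarrow> real) \<Rightarrow> bool" where
  "continuous_paths M Y \<longleftrightarrow> (\<forall>\<omega>\<in>space M. continuous_on {0..} (\<lambda>t. Y t \<omega>))"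

definition progressive :: "(ennreal \<Rightarrow> 'w measure) \<Rightarrow> (real \<Rightarrow> 'w \<Rightarrow> real) \<Rightarrow> bool" where
  "progressive F Y \<longleftrightarrow>
     (\<forall>T\<ge>0. (\<lambda>(t, \<omega>). Y t \<omega>)
        \<in> borel_measurable (restrict_space borel {0..T} \<Otimes>\<^sub>M F (ennreal T)))"


section \<open>Brownian motion and the Ito integral\<close>

definition brownian_motion ::
  "'w measure \<Rightarrow> (ennreal \<Rightarrow> 'w measure) \<Rightarrow> (real \<Rightarrow> 'w \<Rightarrow> real) \<Rightarrow> bool" where
  "brownian_motion M F B \<longleftrightarrow>
     adapted F B \<and> continuous_paths M B \<and> (AE \<omega> in M. B 0 \<omega> = 0) \<and>
     (\<forall>s t. 0 \<le> s \<and> s < t \<longrightarrow>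
        distributed M lborel (\<lambda>\<omega>. B t \<omega> - B s \<omega>) (normal_density 0 (sqrt (t - s))) \<and>
        prob_space.indep_set M (sets (F (ennreal s)))
          {(\<lambda>\<omega>. B t \<omega> - B s \<omega>) -` A \<inter> space M | A. A \<in> sets borel})"

text \<open>
  The data \<open>n\<close>, \<open>p\<close>, \<open>\<xi>\<close> encode the simple process equal to \<open>\<xi> i\<close> on
  \<open>(p i, p (i + 1)]\<close> for \<open>i < n\<close>.
\<close>

definition simple_data ::
  "'w measure \<Rightarrow> (ennreal \<Rightarrow> 'w measure) \<Rightarrow> nat \<Rightarrow> (nat \<Rightarrow> real) \<Rightarrow> (nat \<Rightarrow> 'w \<Rightarrow> real) \<Rightarrow> bool" where
  "simple_data M F n p \<xi> \<longleftrightarrow>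
     0 \<le> p 0 \<and> (\<forall>i<n. p i \<le> p (Suc i)) \<and>
     (\<forall>i<n. \<xi> i \<in> borel_measurable (F (ennreal (p i))) \<and>
            (\<exists>C. \<forall>\<omega>\<in>space M. \<bar>\<xi> i \<omega>\<bar> \<le> C))"

definition simple_process ::
  "nat \<Rightarrow> (nat \<Rightarrow> real) \<Rightarrow> (nat \<Rightarrow> 'w \<Rightarrow> real) \<Rightarrow> real \<Rightarrow> 'w \<Rightarrow> real" where
  "simple_process n p \<xi> t \<omega> = (\<Sum>i<n. \<xi> i \<omega> * indicator {p i<..p (Suc i)} t)"

definition simple_integral ::
  "(real \<Rightarrow> 'w \<Rightarrow> real) \<Rightarrow> nat \<Rightarrow> (nat \<Rightarrow> real) \<Rightarrow> (nat \<Rightarrow> 'w \<Rightarrow> real) \<Rightarrow> real \<Rightarrow> 'w \<Rightarrow> real" where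
  "simple_integral B n p \<xi> t \<omega> =
     (\<Sum>i<n. \<xi> i \<omega> * (B (min t (p (Suc i))) \<omega> - B (min t (p i)) \<omega>))"

text \<open>
  \<open>I\<close> is a continuous version of the stochastic integral \<open>\<integral>\<^sub>0 H dB\<close>: there are simple processes
  converging to \<open>H\<close> in \<open>L\<^sup>2([0, T])\<close> in probability, whose integrals converge to \<open>I\<close>
  uniformly on \<open>[0, T]\<close> in probability, for every \<open>T\<close>.
\<close>

definition is_ito_integral ::
  "'w measure \<Rightarrow> (ennreal \<Rightarrow> 'w measure) \<Rightarrow> (real \<Rightarrow> 'w \<Rightarrow> real) \<Rightarrow> (real \<Rightarrow> 'w \<Rightarrow> real) \<Rightarrow>
     (real \<Rightarrow> 'w \<Rightarrow> real) \<Rightarrow> bool" where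
  "is_ito_integral M F B H I \<longleftrightarrow>
     progressive F H \<and>
     (\<forall>t\<ge>0. I t \<in> borel_measurable M) \<and> continuous_paths M I \<and>
     (\<exists>n p \<xi>. (\<forall>k. simple_data M F (n k) (p k) (\<xi> k)) \<and>
        (\<forall>T\<ge>0. \<forall>\<epsilon>>0.
           (\<lambda>k. measure M {\<omega> \<in> space M.
              (\<integral>\<^sup>+s\<in>{0..T}. ennreal ((simple_process (n k) (p k) (\<xi> k) s \<omega> - H s \<omega>)\<^sup>2) \<partial>lborel)
                > ennreal \<epsilon>}) \<longlonglongrightarrow> 0 \<and>
           (\<lambda>k. measure M {\<omega> \<in> space M. \<exists>t\<in>{0..T}.
              \<bar>simple_integral B (n k) (p k) (\<xi> k) t \<omega> - I t \<omega>\<bar> > \<epsilon>}) \<longlonglongrightarrow> 0))"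


section \<open>The diffusion\<close>

text \<open>
  Solutions of \<open>dX = \<mu>(X) dt + \<sigma>(X) dB\<close>, \<open>X\<^sub>0 = x\<close>, with state space \<open>(0, \<infinity>)\<close>.
\<close>

definition sde_solution ::
  "'w measure \<Rightarrow> (ennreal \<Rightarrow> 'w measure) \<Rightarrow> (real \<Rightarrow> 'w \<Rightarrow> real) \<Rightarrow> (real \<Rightarrow> real) \<Rightarrow>
     (real \<Rightarrow> real) \<Rightarrow> real \<Rightarrow> (real \<Rightarrow> 'w \<Rightarrow> real) \<Rightarrow> bool" where
  "sde_solution M F B \<mu> \<sigma> x Y \<longleftrightarrow>
     adapted F Y \<and> continuous_paths M Y \<and>
     (\<forall>t\<ge>0. \<forall>\<omega>\<in>space M. Y t \<omega> > 0) \<and>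
     (AE \<omega> in M. Y 0 \<omega> = x) \<and>
     (AE \<omega> in M. \<forall>t\<ge>0. set_integrable lborel {0..t} (\<lambda>s. \<mu> (Y s \<omega>)) \<and>
                        set_integrable lborel {0..t} (\<lambda>s. (\<sigma> (Y s \<omega>))\<^sup>2)) \<and>
     (\<exists>I. is_ito_integral M F B (\<lambda>s \<omega>. \<sigma> (Y s \<omega>)) I \<and>
        (AE \<omega> in M. \<forall>t\<ge>0. Y t \<omega> = x + (LBINT s:{0..t}. \<mu> (Y s \<omega>)) + I t \<omega>))"

text \<open>The filtration generated by \<open>B\<close>, augmented by the null sets.\<close>

definition augmented_filtration ::
  "'w measure \<Rightarrow> (real \<Rightarrow> 'w \<Rightarrow> real) \<Rightarrow> ennreal \<Rightarrow> 'w measure" where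
  "augmented_filtration M B t =
     sigma (space M)
       ({B s -` A \<inter> space M | s A. 0 \<le> s \<and> ennreal s \<le> t \<and> A \<in> sets borel} \<union> null_sets M)"

definition unique_strong_solution ::
  "'w measure \<Rightarrow> (ennreal \<Rightarrow> 'w measure) \<Rightarrow> (real \<Rightarrow> 'w \<Rightarrow> real) \<Rightarrow> (real \<Rightarrow> real) \<Rightarrow>
     (real \<Rightarrow> real) \<Rightarrow> real \<Rightarrow> (real \<Rightarrow> 'w \<Rightarrow> real) \<Rightarrow> bool" where
  "unique_strong_solution M F B \<mu> \<sigma> x Y \<longleftrightarrow>
     sde_solution M F B \<mu> \<sigma> x Y \<and> adapted (augmented_filtration M B) Y \<and>
     (\<forall>Z. sde_solution M F B \<mu> \<sigma> x Z \<longrightarrow> (AE \<omega> in M. \<forall>t\<ge>0. Z t \<omega> = Y t \<omega>))"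

text \<open>The hitting time \<open>\<tau>\<^sub>\<kappa>\<close>, with \<open>inf \<emptyset> = \<infinity>\<close>.\<close>

definition hitting_time :: "(real \<Rightarrow> 'w \<Rightarrow> real) \<Rightarrow> real \<Rightarrow> 'w \<Rightarrow> ennreal" where
  "hitting_time Y \<kappa> \<omega> = Inf (ennreal ` {t. 0 \<le> t \<and> Y t \<omega> = \<kappa>})"

text \<open>
  Throughout, \<open>X x\<close> is the solution started at \<open>x\<close>, so that \<open>E\<^sub>x[f(X)]\<close> is the expectation of
  \<open>f(X x)\<close> under the one measure \<open>M\<close>.
\<close>

definition regular_diffusion :: "'w measure \<Rightarrow> (real \<Rightarrow> real \<Rightarrow> 'w \<Rightarrow> real) \<Rightarrow> bool" where
  "regular_diffusion M X \<longleftrightarrow>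
     (\<forall>x>0. \<forall>y>0. measure M {\<omega> \<in> space M. hitting_time (X x) y \<omega> < \<infinity>} > 0)"

text \<open>
  A natural boundary point is one that is neither accessible (it is not attained or approached in
  finite time) nor an entrance: as the starting point tends to it, the probability of
  hitting a given interior point within a given time tends to zero.
\<close>

definition natural_boundary_0 :: "'w measure \<Rightarrow> (real \<Rightarrow> real \<Rightarrow> 'w \<Rightarrow> real) \<Rightarrow> bool" where
  "natural_boundary_0 M X \<longleftrightarrow>
     (\<forall>x>0. AE \<omega> in M. \<forall>T\<ge>0. 0 < (INF t\<in>{0..T}. X x t \<omega>)) \<and>
     (\<forall>\<kappa>>0. \<forall>t\<ge>0.
        ((\<lambda>x. measure M {\<omega> \<in> space M. hitting_time (X x) \<kappa> \<omega> \<le> ennreal t}) \<longlongrightarrow> 0) (at_right 0))"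

locale diffusion_model = prob_space M + complete_measure M + filtration "space M" F
  for M :: "'w measure" and F :: "ennreal \<Rightarrow> 'w measure" +
  fixes B :: "real \<Rightarrow> 'w \<Rightarrow> real"
    and \<mu> \<sigma> :: "real \<Rightarrow> real"
    and X :: "real \<Rightarrow> real \<Rightarrow> 'w \<Rightarrow> real"
  assumes sets_F: "\<And>t. sets (F t) \<subseteq> sets M"
    and brownian_motion: "brownian_motion M F B"
    and drift_measurable: "\<mu> \<in> borel_measurable (restrict_space borel {0<..})"
    and volatility_measurable: "\<sigma> \<in> borel_measurable (restrict_space borel {0<..})"
    and volatility_pos: "\<And>x. x > 0 \<Longrightarrow> \<sigma> x > 0"
    and strong_solution: "\<And>x. x > 0 \<Longrightarrow> unique_strong_solution M F B \<mu> \<sigma> x (X x)"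
    and regular: "regular_diffusion M X"
    and natural_boundary: "natural_boundary_0 M X"


section \<open>The fundamental solutions\<close>

text \<open>The discount factor \<open>e\<^bsup>-r\<tau>\<^esup>\<close>, which vanishes for \<open>\<tau> = \<infinity>\<close>.\<close>

definition discount :: "real \<Rightarrow> ennreal \<Rightarrow> real" where
  "discount r \<tau> = (if \<tau> = \<infinity> then 0 else exp (- r * enn2real \<tau>))"

definition C2_on :: "real set \<Rightarrow> (real \<Rightarrow> real) \<Rightarrow> bool" where
  "C2_on S u \<longleftrightarrow>
     (\<forall>x\<in>S. u differentiable (at x)) \<and> (\<forall>x\<in>S. deriv u differentiable (at x)) \<and>
     continuous_on S (deriv (deriv u))"

definition generator :: "(real \<Rightarrow> real) \<Rightarrow> (real \<Rightarrow> real) \<Rightarrow> (real \<Rightarrow> real) \<Rightarrow> real \<Rightarrow> real" where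
  "generator \<mu> \<sigma> u x = 1 / 2 * (\<sigma> x)\<^sup>2 * deriv (deriv u) x + \<mu> x * deriv u x"

definition positive_harmonic ::
  "(real \<Rightarrow> real) \<Rightarrow> (real \<Rightarrow> real) \<Rightarrow> real \<Rightarrow> (real \<Rightarrow> real) \<Rightarrow> bool" where
  "positive_harmonic \<mu> \<sigma> r u \<longleftrightarrow>
     (\<forall>x>0. u x > 0) \<and> C2_on {0<..} u \<and> (\<forall>x>0. generator \<mu> \<sigma> u x - r * u x = 0)"

definition increasing_fundamental_solution ::
  "'w measure \<Rightarrow> (real \<Rightarrow> real) \<Rightarrow> (real \<Rightarrow> real) \<Rightarrow> (real \<Rightarrow> real \<Rightarrow> 'w \<Rightarrow> real) \<Rightarrow> real \<Rightarrow>
     (real \<Rightarrow> real) \<Rightarrow> bool" where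
  "increasing_fundamental_solution M \<mu> \<sigma> X r \<psi> \<longleftrightarrow>
     positive_harmonic \<mu> \<sigma> r \<psi> \<and> strict_mono_on {0<..} \<psi> \<and>
     (\<forall>x \<kappa>. 0 < x \<and> x \<le> \<kappa> \<longrightarrow>
        (\<integral>\<omega>. discount r (hitting_time (X x) \<kappa> \<omega>) \<partial>M) = \<psi> x / \<psi> \<kappa>) \<and>
     (\<psi> \<longlongrightarrow> 0) (at_right 0)"

definition decreasing_fundamental_solution ::
  "'w measure \<Rightarrow> (real \<Rightarrow> real) \<Rightarrow> (real \<Rightarrow> real) \<Rightarrow> (real \<Rightarrow> real \<Rightarrow> 'w \<Rightarrow> real) \<Rightarrow> real \<Rightarrow>
     (real \<Rightarrow> real) \<Rightarrow> bool" where
  "decreasing_fundamental_solution M \<mu> \<sigma> X r \<phi> \<longleftrightarrow>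
     positive_harmonic \<mu> \<sigma> r \<phi> \<and> strict_antimono_on {0<..} \<phi> \<and>
     (\<forall>x \<kappa>. 0 < \<kappa> \<and> \<kappa> \<le> x \<longrightarrow>
        (\<integral>\<omega>. discount r (hitting_time (X x) \<kappa> \<omega>) \<partial>M) = \<phi> x / \<phi> \<kappa>) \<and>
     filterlim \<phi> at_top (at_right 0) \<and> (\<phi> \<longlongrightarrow> 0) at_top"


section \<open>The stopping problem\<close>

definition payoff :: "real \<Rightarrow> real \<Rightarrow> real" where
  "payoff q x = max (q - x) 0"

text \<open>
  The supremum is over a set of reals contained in \<open>[0, q]\<close> when \<open>r, q > 0\<close>.  On
  \<open>{\<tau> < \<tau>\<^sub>d}\<close> the time \<open>\<tau>\<close> is finite, so \<^const>\<open>enn2real\<close> does not lose anything there.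
\<close>

definition barrier_value ::
  "'w measure \<Rightarrow> (ennreal \<Rightarrow> 'w measure) \<Rightarrow> (real \<Rightarrow> real \<Rightarrow> 'w \<Rightarrow> real) \<Rightarrow>
     real \<Rightarrow> real \<Rightarrow> real \<Rightarrow> real \<Rightarrow> real" where
  "barrier_value M F X d r q x =
     (SUP \<tau>\<in>{\<tau>. stopping_time F \<tau>}.
        \<integral>\<omega>. discount r (\<tau> \<omega>) * payoff q (X x (enn2real (\<tau> \<omega>)) \<omega>) *
            (if \<tau> \<omega> < hitting_time (X x) d \<omega> then 1 else 0) \<partial>M)"

definition optimal_price_level ::
  "'w measure \<Rightarrow> (ennreal \<Rightarrow> 'w measure) \<Rightarrow> (real \<Rightarrow> real \<Rightarrow> 'w \<Rightarrow> real) \<Rightarrow>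
     (real \<Rightarrow> real) \<Rightarrow> (real \<Rightarrow> real) \<Rightarrow> real \<Rightarrow> real \<Rightarrow> real \<Rightarrow> real \<Rightarrow> bool" where
  "optimal_price_level M F X \<psi> \<phi> d r q x\<^sub>0 \<longleftrightarrow>
     x\<^sub>0 \<in> {0<..<q} \<and>
     {x \<in> {0<..<d}. barrier_value M F X d r q x = payoff q x} = {0<..x\<^sub>0} \<and>
     (deriv (payoff q) x\<^sub>0 * \<psi> x\<^sub>0 - payoff q x\<^sub>0 * deriv \<psi> x\<^sub>0) / (\<psi> d / \<phi> d) =
       deriv (payoff q) x\<^sub>0 * \<phi> x\<^sub>0 - payoff q x\<^sub>0 * deriv \<phi> x\<^sub>0"

end

theory Submission
  imports Defs
begin

text \<open>
  The optimal level is the right end of the stopping region \<open>(0, x\<^sub>0]\<close>, so it moves to the right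
  whenever the stopping region grows, and this follows by comparing value functions.
  Let \<open>V\<^sub>1\<close>, \<open>V\<^sub>2\<close> be the values for parameters with \<open>d\<^sub>2 \<le> d\<^sub>1\<close>, \<open>r\<^sub>1 \<le> r\<^sub>2\<close>, \<open>q\<^sub>1 \<le> q\<^sub>2\<close>.  For every
  stopping time, a lower barrier is hit earlier (the path is continuous and starts below it) and so
  kills more reward, a larger rate discounts more, and raising the strike by \<open>q\<^sub>2 - q\<^sub>1\<close> raises the
  payoff by at most that amount.  Hence \<open>V\<^sub>2 \<le> V\<^sub>1 + (q\<^sub>2 - q\<^sub>1)\<close> on \<open>(0, d\<^sub>2]\<close>
  (lemma \<open>barrier_value_le\<close>).  At the level \<open>a\<close> of the first problem, \<open>V\<^sub>1 a = q\<^sub>1 - a\<close>, so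
  \<open>V\<^sub>2 a \<le> q\<^sub>2 - a\<close>; stopping at once gives the reverse inequality (lemma \<open>payoff_le_barrier_value\<close>).
  Thus \<open>a\<close> lies in the stopping region of the second problem, that is, below its level.  The three
  claims are the cases in which only one parameter moves.

  What remains is measurability: rewards are compared through their expectations, and the
  expectation of a reward that was not measurable would be zero by convention.  Continuity of the
  paths reduces both the value of the process at a stopping time and the event that the barrier
  has been hit to countably many times.
\<close>

section \<open>Hitting and stopping a continuous process\<close>

text \<open>
  The hitting set of a continuous path is closed, so its infimum is attained when it is finite.
\<close>

lemma hitting_time_le_iff:
  assumes cont: "continuous_on {0..} (\<lambda>t. Y t \<omega>)" and t: "0 \<le> t"
  shows "hitting_time Y d \<omega> \<le> ennreal t \<longleftrightarrow> (\<exists>s\<in>{0..t}. Y s \<omega> = d)"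
proof
  assume le: "hitting_time Y d \<omega> \<le> ennreal t"
  define H where "H = {s. 0 \<le> s \<and> Y s \<omega> = d}"
  have "closed ({0..} \<inter> (\<lambda>s. Y s \<omega>) -` {d})"
    using cont by (intro continuous_closed_preimage) auto
  also have "{0..} \<inter> (\<lambda>s. Y s \<omega>) -` {d} = H"
    by (auto simp: H_def)
  finally have closed: "closed H" .
  have ne: "H \<noteq> {}"
  proof
    assume "H = {}"
    then have "hitting_time Y d \<omega> = top"
      by (simp add: hitting_time_def H_def[symmetric])
    with le show False
      by (simp add: top_unique)
  qed
  have bdd: "bdd_below H"
    by (auto simp: H_def bdd_below_def)
  have mem: "Inf H \<in> H"
    using closed_contains_Inf[OF ne bdd closed] .
  have "ennreal (Inf H) \<le> hitting_time Y d \<omega>"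
    unfolding hitting_time_def H_def[symmetric]
    by (rule INF_greatest) (auto intro!: ennreal_leI cInf_lower bdd)
  also note le
  finally have "ennreal (Inf H) \<le> ennreal t" .
  then have "Inf H \<le> t"
    using t by simp
  with mem show "\<exists>s\<in>{0..t}. Y s \<omega> = d"
    by (auto simp: H_def intro!: bexI[of _ "Inf H"])
next
  assume "\<exists>s\<in>{0..t}. Y s \<omega> = d"
  then obtain s where "0 \<le> s" "s \<le> t" "Y s \<omega> = d"
    by auto
  then have "hitting_time Y d \<omega> \<le> ennreal s" "ennreal s \<le> ennreal t"
    unfolding hitting_time_def by (auto intro!: INF_lower ennreal_leI)
  then show "hitting_time Y d \<omega> \<le> ennreal t"
    by (rule order_trans)
qed

lemma hitting_time_mono_level:
  assumes cont: "continuous_on {0..} (\<lambda>t. Y t \<omega>)"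
    and "Y 0 \<omega> \<le> d'" "d' \<le> d"
  shows "hitting_time Y d' \<omega> \<le> hitting_time Y d \<omega>"
  unfolding hitting_time_def[of Y d]
proof (rule INF_greatest)
  fix t assume "t \<in> {t. 0 \<le> t \<and> Y t \<omega> = d}"
  then have t: "0 \<le> t" "Y t \<omega> = d"
    by auto
  have "\<exists>s\<ge>0. s \<le> t \<and> Y s \<omega> = d'"
    using t assms by (intro IVT') (auto intro: continuous_on_subset)
  then show "hitting_time Y d' \<omega> \<le> ennreal t"
    using t by (auto simp: hitting_time_le_iff[where Y = Y and \<omega> = \<omega>, OF cont])
qed

text \<open>
  Rounding a nonnegative time up to the grid of mesh \<open>1 / (n + 1)\<close> makes it one of countably many
  nonnegative times; a continuous path recovers its value at \<open>s\<close> from these as the grid is refined.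
\<close>

lemma round_up_tendsto:
  fixes s :: real
  assumes "0 \<le> s"
  shows "(\<lambda>n. real (nat \<lceil>real (Suc n) * s\<rceil>) / real (Suc n)) \<longlonglongrightarrow> s"
proof (rule tendsto_sandwich)
  show "\<forall>\<^sub>F n in sequentially. s \<le> real (nat \<lceil>real (Suc n) * s\<rceil>) / real (Suc n)"
    by (intro always_eventually allI)
       (simp add: field_simps del: of_nat_Suc, linarith)
  show "\<forall>\<^sub>F n in sequentially.
      real (nat \<lceil>real (Suc n) * s\<rceil>) / real (Suc n) \<le> s + 1 / real (Suc n)"
  proof (intro always_eventually allI)
    fix n
    have "0 \<le> real (Suc n) * s"
      using assms by simp
    then have "real (nat \<lceil>real (Suc n) * s\<rceil>) \<le> real (Suc n) * s + 1"
      by linarith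
    then show "real (nat \<lceil>real (Suc n) * s\<rceil>) / real (Suc n) \<le> s + 1 / real (Suc n)"
      by (simp add: field_simps del: of_nat_Suc)
  qed
  show "(\<lambda>n. s + 1 / real (Suc n)) \<longlonglongrightarrow> s"
    using tendsto_add[OF tendsto_const[of s] LIMSEQ_Suc[OF lim_1_over_n]] by simp
qed simp

text \<open>
  On the compact interval \<open>[0, t]\<close> the distance to \<open>d\<close> attains its minimum, so a continuous path
  that comes arbitrarily near \<open>d\<close> at the countably many times considered does hit it.
\<close>

lemma hits_level_iff_countable:
  fixes y :: "real \<Rightarrow> real"
  assumes cont: "continuous_on {0..} y" and t: "0 \<le> t"
  shows "(\<exists>s\<in>{0..t}. y s = d) \<longleftrightarrow>
    (\<forall>m. \<exists>i n. \<bar>y (min t (real i / real (Suc n))) - d\<bar> < 1 / real (Suc m))"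
proof
  assume "\<exists>s\<in>{0..t}. y s = d"
  then obtain s where s: "0 \<le> s" "s \<le> t" "y s = d"
    by auto
  let ?a = "\<lambda>n. min t (real (nat \<lceil>real (Suc n) * s\<rceil>) / real (Suc n))"
  have "?a \<longlonglongrightarrow> min t s"
    using s by (intro tendsto_min tendsto_const round_up_tendsto)
  moreover have "min t s = s"
    using s by simp
  ultimately have "?a \<longlonglongrightarrow> s"
    by metis
  moreover have "\<forall>\<^sub>F n in sequentially. ?a n \<in> {0..}"
    using t by (intro always_eventually allI) simp
  ultimately have "(\<lambda>n. y (?a n)) \<longlonglongrightarrow> y s"
    using s by (intro continuous_on_tendsto_compose[OF cont, of ?a]) auto
  then have "(\<lambda>n. \<bar>y (?a n) - d\<bar>) \<longlonglongrightarrow> \<bar>y s - d\<bar>"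
    by (intro tendsto_intros)
  with s have lim: "(\<lambda>n. \<bar>y (?a n) - d\<bar>) \<longlonglongrightarrow> 0"
    by simp
  show "\<forall>m. \<exists>i n. \<bar>y (min t (real i / real (Suc n))) - d\<bar> < 1 / real (Suc m)"
  proof
    fix m
    have "\<forall>\<^sub>F n in sequentially. \<bar>y (?a n) - d\<bar> < 1 / real (Suc m)"
      by (rule order_tendstoD(2)[OF lim]) simp
    then obtain n where "\<bar>y (?a n) - d\<bar> < 1 / real (Suc m)"
      using eventually_happens'[OF sequentially_bot] by blast
    then show "\<exists>i n. \<bar>y (min t (real i / real (Suc n))) - d\<bar> < 1 / real (Suc m)"
      by blast
  qed
next
  assume near: "\<forall>m. \<exists>i n. \<bar>y (min t (real i / real (Suc n))) - d\<bar> < 1 / real (Suc m)"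
  have "continuous_on {0..t} (\<lambda>s. \<bar>y s - d\<bar>)"
    by (intro continuous_intros continuous_on_subset[OF cont]) auto
  then obtain s where s: "s \<in> {0..t}" and min: "\<And>u. u \<in> {0..t} \<Longrightarrow> \<bar>y s - d\<bar> \<le> \<bar>y u - d\<bar>"
    using continuous_attains_inf[of "{0..t}" "\<lambda>s. \<bar>y s - d\<bar>"] t by auto
  have "\<bar>y s - d\<bar> = 0"
  proof (rule ccontr)
    assume "\<bar>y s - d\<bar> \<noteq> 0"
    then have "0 < \<bar>y s - d\<bar>"
      by simp
    from nat_approx_posE[OF this] obtain m where m: "1 / real (Suc m) < \<bar>y s - d\<bar>" .
    from near obtain i n where "\<bar>y (min t (real i / real (Suc n))) - d\<bar> < 1 / real (Suc m)"
      by blast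
    moreover have "\<bar>y s - d\<bar> \<le> \<bar>y (min t (real i / real (Suc n))) - d\<bar>"
      using t by (intro min) auto
    ultimately show False
      using m by linarith
  qed
  with s show "\<exists>s\<in>{0..t}. y s = d"
    by auto
qed

lemma measurable_hitting_time:
  assumes meas: "\<And>t. 0 \<le> t \<Longrightarrow> Y t \<in> borel_measurable M"
    and cont: "continuous_paths M Y"
  shows "hitting_time Y d \<in> borel_measurable M"
proof (rule borel_measurableI_le)
  fix c :: ennreal
  show "{\<omega> \<in> space M. hitting_time Y d \<omega> \<le> c} \<in> sets M"
  proof (cases c)
    case (real t)
    have [measurable]: "Y (min t (real i / real (Suc n))) \<in> borel_measurable M" for i n
      using real by (intro meas) auto
    have "{\<omega> \<in> space M. hitting_time Y d \<omega> \<le> c} = {\<omega> \<in> space M.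
        \<forall>m. \<exists>i n. \<bar>Y (min t (real i / real (Suc n))) \<omega> - d\<bar> < 1 / real (Suc m)}"
      using cont real
      by (auto simp: hitting_time_le_iff hits_level_iff_countable continuous_paths_def
          simp del: of_nat_Suc)
    also have "\<dots> \<in> sets M"
      by measurable
    finally show ?thesis .
  next
    case top
    then show ?thesis
      by simp
  qed
qed

lemma measurable_value_at_random_time:
  fixes Y :: "real \<Rightarrow> 'w \<Rightarrow> real"
  assumes meas: "\<And>t. 0 \<le> t \<Longrightarrow> Y t \<in> borel_measurable M"
    and cont: "continuous_paths M Y"
    and \<rho>[measurable]: "\<rho> \<in> borel_measurable M" and \<rho>_nonneg: "\<And>\<omega>. 0 \<le> \<rho> \<omega>"
  shows "(\<lambda>\<omega>. Y (\<rho> \<omega>) \<omega>) \<in> borel_measurable M"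
proof (rule borel_measurable_LIMSEQ_real)
  fix \<omega> assume "\<omega> \<in> space M"
  then have cont\<omega>: "continuous_on {0..} (\<lambda>t. Y t \<omega>)"
    using cont by (simp add: continuous_paths_def)
  show "(\<lambda>n. Y (real (nat \<lceil>real (Suc n) * \<rho> \<omega>\<rceil>) / real (Suc n)) \<omega>) \<longlonglongrightarrow> Y (\<rho> \<omega>) \<omega>"
  proof (rule continuous_on_tendsto_compose[OF cont\<omega> round_up_tendsto[OF \<rho>_nonneg]])
    show "\<forall>\<^sub>F n in sequentially. real (nat \<lceil>real (Suc n) * \<rho> \<omega>\<rceil>) / real (Suc n) \<in> {0..}"
      unfolding atLeast_iff
      by (intro always_eventually allI divide_nonneg_nonneg of_nat_0_le_iff)
  qed (simp add: \<rho>_nonneg)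
next
  fix n
  have "(\<lambda>\<omega>. Y (real i / real (Suc n)) \<omega>) \<in> borel_measurable M" for i
    by (intro meas) auto
  moreover have "(\<lambda>\<omega>. nat \<lceil>real (Suc n) * \<rho> \<omega>\<rceil>) \<in> measurable M (count_space UNIV)"
    by measurable
  ultimately show "(\<lambda>\<omega>. Y (real (nat \<lceil>real (Suc n) * \<rho> \<omega>\<rceil>) / real (Suc n)) \<omega>) \<in> borel_measurable M"
    by (rule measurable_compose_countable)
qed


section \<open>Rewards and their dependence on the parameters\<close>

definition reward ::
  "(real \<Rightarrow> 'w \<Rightarrow> real) \<Rightarrow> real \<Rightarrow> real \<Rightarrow> real \<Rightarrow> ('w \<Rightarrow> ennreal) \<Rightarrow> 'w \<Rightarrow> real" where
  "reward Y d r q \<tau> \<omega> = discount r (\<tau> \<omega>) * payoff q (Y (enn2real (\<tau> \<omega>)) \<omega>) *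
     (if \<tau> \<omega> < hitting_time Y d \<omega> then 1 else 0)"

lemma barrier_value_eq_reward:
  "barrier_value M F X d r q x = (SUP \<tau>\<in>{\<tau>. stopping_time F \<tau>}. \<integral>\<omega>. reward (X x) d r q \<tau> \<omega> \<partial>M)"
  by (simp add: barrier_value_def reward_def)

lemma discount_nonneg: "0 \<le> discount r t"
  by (simp add: discount_def)

lemma discount_le_1: "0 \<le> r \<Longrightarrow> discount r t \<le> 1"
  by (simp add: discount_def)

lemma discount_antimono: "r \<le> r' \<Longrightarrow> discount r' t \<le> discount r t"
  by (simp add: discount_def mult_right_mono)

lemma payoff_nonneg: "0 \<le> payoff q y"
  by (simp add: payoff_def)

lemma payoff_le_strike: "0 \<le> q \<Longrightarrow> 0 \<le> y \<Longrightarrow> payoff q y \<le> q"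
  by (simp add: payoff_def)

lemma payoff_le_shift: "q \<le> q' \<Longrightarrow> payoff q' y \<le> payoff q y + (q' - q)"
  by (simp add: payoff_def)

lemma reward_nonneg: "0 \<le> reward Y d r q \<tau> \<omega>"
  by (simp add: reward_def discount_nonneg payoff_nonneg)

lemma reward_le_strike:
  assumes "0 \<le> r" "0 \<le> q" "0 \<le> Y (enn2real (\<tau> \<omega>)) \<omega>"
  shows "reward Y d r q \<tau> \<omega> \<le> q"
proof -
  have "discount r (\<tau> \<omega>) * payoff q (Y (enn2real (\<tau> \<omega>)) \<omega>) \<le> 1 * q"
    using assms by (intro mult_mono discount_le_1 payoff_le_strike discount_nonneg payoff_nonneg) auto
  with \<open>0 \<le> q\<close> show ?thesis
    by (simp add: reward_def)
qed

text \<open>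
  The increase of the strike enters undiscounted, since the discount factor is at most one.
\<close>

lemma reward_le_shift:
  assumes "0 \<le> r" "r \<le> r'" "q \<le> q'"
    and hit: "hitting_time Y d' \<omega> \<le> hitting_time Y d \<omega>"
  shows "reward Y d' r' q' \<tau> \<omega> \<le> reward Y d r q \<tau> \<omega> + (q' - q)"
proof (cases "\<tau> \<omega> < hitting_time Y d' \<omega>")
  case True
  let ?y = "Y (enn2real (\<tau> \<omega>)) \<omega>"
  have "discount r' (\<tau> \<omega>) * payoff q' ?y \<le> discount r (\<tau> \<omega>) * (payoff q ?y + (q' - q))"
    using assms
    by (intro mult_mono discount_antimono payoff_le_shift discount_nonneg payoff_nonneg)
  also have "\<dots> \<le> discount r (\<tau> \<omega>) * payoff q ?y + 1 * (q' - q)"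
    unfolding distrib_left using assms
    by (intro add_left_mono mult_right_mono discount_le_1) auto
  finally show ?thesis
    using True less_le_trans[OF True hit] by (simp add: reward_def)
next
  case False
  with \<open>q \<le> q'\<close> show ?thesis
    using reward_nonneg[of Y d r q \<tau> \<omega>] by (simp add: reward_def[of Y d'])
qed


section \<open>Comparison of the value functions\<close>

context diffusion_model
begin

lemma solution_paths:
  assumes "0 < x"
  shows "continuous_paths M (X x)"
    and "0 \<le> t \<Longrightarrow> \<omega> \<in> space M \<Longrightarrow> 0 < X x t \<omega>"
    and "AE \<omega> in M. X x 0 \<omega> = x"
    and "0 \<le> t \<Longrightarrow> X x t \<in> borel_measurable M"
proof -
  have sol: "sde_solution M F B \<mu> \<sigma> x (X x)"
    using strong_solution[OF assms] by (simp add: unique_strong_solution_def)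
  then show "continuous_paths M (X x)" "0 \<le> t \<Longrightarrow> \<omega> \<in> space M \<Longrightarrow> 0 < X x t \<omega>"
    "AE \<omega> in M. X x 0 \<omega> = x"
    by (auto simp: sde_solution_def)
  have "0 \<le> t \<Longrightarrow> X x t \<in> borel_measurable (F (ennreal t))"
    using sol by (auto simp: sde_solution_def adapted_def)
  then show "0 \<le> t \<Longrightarrow> X x t \<in> borel_measurable M"
    using measurable_mono[of borel borel "F (ennreal t)" M] sets_F[of "ennreal t"] space_F
    by auto
qed

lemma reward_integrable:
  assumes "0 < x" "0 \<le> r" "0 \<le> q" "stopping_time F \<tau>"
  shows "integrable M (reward (X x) d r q \<tau>)"
proof (rule integrable_const_bound)
  show "AE \<omega> in M. norm (reward (X x) d r q \<tau> \<omega>) \<le> q"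
    using assms
    by (intro AE_I2) (auto simp: reward_nonneg
        intro!: reward_le_strike less_imp_le[OF solution_paths(2)])
  have [measurable]: "\<tau> \<in> borel_measurable M"
    using assms by (intro measurable_stopping_time[of F]) (auto simp: sets_F space_F)
  have [measurable]: "hitting_time (X x) d \<in> borel_measurable M"
    by (rule measurable_hitting_time) (use solution_paths[OF \<open>0 < x\<close>] in auto)
  have [measurable]: "(\<lambda>\<omega>. X x (enn2real (\<tau> \<omega>)) \<omega>) \<in> borel_measurable M"
    by (rule measurable_value_at_random_time) (use solution_paths[OF \<open>0 < x\<close>] in auto)
  show "reward (X x) d r q \<tau> \<in> borel_measurable M"
    unfolding reward_def[abs_def] discount_def payoff_def by measurable
qed

lemma expected_reward_le_barrier_value:
  assumes "0 < x" "0 \<le> r" "0 \<le> q" "stopping_time F \<tau>"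
  shows "(\<integral>\<omega>. reward (X x) d r q \<tau> \<omega> \<partial>M) \<le> barrier_value M F X d r q x"
  unfolding barrier_value_eq_reward
proof (rule cSUP_upper)
  show "bdd_above ((\<lambda>\<tau>. \<integral>\<omega>. reward (X x) d r q \<tau> \<omega> \<partial>M) ` {\<tau>. stopping_time F \<tau>})"
  proof (rule bdd_aboveI2)
    fix \<tau> assume "\<tau> \<in> {\<tau>. stopping_time F \<tau>}"
    then show "(\<integral>\<omega>. reward (X x) d r q \<tau> \<omega> \<partial>M) \<le> q"
      using assms
      by (intro integral_le_const reward_integrable AE_I2)
         (auto intro!: reward_le_strike less_imp_le[OF solution_paths(2)])
  qed
qed (use assms in auto)

text \<open>
  Stopping at time zero earns the payoff at the starting point, because the process starts off
  the barrier and therefore does not hit it immediately.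
\<close>

lemma payoff_le_barrier_value:
  assumes "0 < x" "x \<noteq> d" "0 \<le> r" "0 \<le> q"
  shows "payoff q x \<le> barrier_value M F X d r q x"
proof -
  have "AE \<omega> in M. reward (X x) d r q (\<lambda>_. 0) \<omega> = payoff q x"
    using solution_paths(3)[OF \<open>0 < x\<close>] AE_space
  proof eventually_elim
    case (elim \<omega>)
    then have "\<not> hitting_time (X x) d \<omega> \<le> ennreal 0"
      using solution_paths(1)[OF \<open>0 < x\<close>] \<open>x \<noteq> d\<close>
      by (subst hitting_time_le_iff) (auto simp: continuous_paths_def)
    with elim show ?case
      by (simp add: reward_def discount_def zero_less_iff_neq_zero)
  qed
  moreover have "integrable M (reward (X x) d r q (\<lambda>_. 0))"
    using assms by (intro reward_integrable stopping_time_const)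
  ultimately have "(\<integral>\<omega>. reward (X x) d r q (\<lambda>_. 0) \<omega> \<partial>M) = (\<integral>\<omega>. payoff q x \<partial>M)"
    by (intro integral_cong_AE) auto
  then show ?thesis
    using expected_reward_le_barrier_value[OF assms(1,3,4) stopping_time_const, of d 0]
    by (simp add: prob_space)
qed

lemma barrier_value_le:
  assumes "0 < x" "x \<le> d'" "d' \<le> d" "0 \<le> r" "r \<le> r'" "0 \<le> q" "q \<le> q'"
  shows "barrier_value M F X d' r' q' x \<le> barrier_value M F X d r q x + (q' - q)"
  unfolding barrier_value_eq_reward[where d = d']
proof (rule cSUP_least)
  show "{\<tau>. stopping_time F \<tau>} \<noteq> {}"
    using stopping_time_const by blast
next
  fix \<tau> assume "\<tau> \<in> {\<tau>. stopping_time F \<tau>}"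
  then have \<tau>: "stopping_time F \<tau>"
    by simp
  have int: "integrable M (reward (X x) d r q \<tau>)" "integrable M (reward (X x) d' r' q' \<tau>)"
    using assms \<tau> by (auto intro!: reward_integrable)
  have "AE \<omega> in M. reward (X x) d' r' q' \<tau> \<omega> \<le> reward (X x) d r q \<tau> \<omega> + (q' - q)"
    using solution_paths(3)[OF \<open>0 < x\<close>] AE_space
  proof eventually_elim
    case (elim \<omega>)
    with assms solution_paths(1)[OF \<open>0 < x\<close>] show ?case
      by (intro reward_le_shift hitting_time_mono_level) (auto simp: continuous_paths_def)
  qed
  then have "(\<integral>\<omega>. reward (X x) d' r' q' \<tau> \<omega> \<partial>M) \<le> (\<integral>\<omega>. reward (X x) d r q \<tau> \<omega> + (q' - q) \<partial>M)"
    using int by (intro integral_mono_AE) auto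
  also have "\<dots> = (\<integral>\<omega>. reward (X x) d r q \<tau> \<omega> \<partial>M) + (q' - q)"
    using int by (simp add: prob_space)
  also have "\<dots> \<le> barrier_value M F X d r q x + (q' - q)"
    using assms \<tau> by (intro add_right_mono expected_reward_le_barrier_value)
  finally show "(\<integral>\<omega>. reward (X x) d' r' q' \<tau> \<omega> \<partial>M) \<le> barrier_value M F X d r q x + (q' - q)" .
qed

text \<open>
  The level \<open>a\<close> belongs to the stopping region of the second problem: its value at \<open>a\<close> is at most
  \<open>(q - a) + (q' - q) = q' - a\<close>, and it never falls below the payoff.
\<close>

lemma optimal_price_level_mono:
  assumes level: "optimal_price_level M F X \<psi> \<phi> d r q a"
    and level': "optimal_price_level M F X \<psi>' \<phi>' d' r' q' b"
    and "d' \<le> d" "0 \<le> r" "r \<le> r'" "q \<le> q'" "q' < d'"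
  shows "a \<le> b"
proof -
  have a: "0 < a" "a < q"
    and region: "{x \<in> {0<..<d}. barrier_value M F X d r q x = payoff q x} = {0<..a}"
    using level by (auto simp: optimal_price_level_def)
  have region': "{x \<in> {0<..<d'}. barrier_value M F X d' r' q' x = payoff q' x} = {0<..b}"
    using level' by (auto simp: optimal_price_level_def)
  have "a \<in> {x \<in> {0<..<d}. barrier_value M F X d r q x = payoff q x}"
    unfolding region using a by simp
  then have "barrier_value M F X d r q a = q - a"
    using a by (simp add: payoff_def)
  then have "barrier_value M F X d' r' q' a \<le> q' - a"
    using barrier_value_le[of a d' d r r' q q'] a assms by simp
  moreover have "payoff q' a \<le> barrier_value M F X d' r' q' a"
    using a assms by (intro payoff_le_barrier_value) auto
  ultimately have "barrier_value M F X d' r' q' a = payoff q' a"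
    using a assms by (simp add: payoff_def)
  then have "a \<in> {x \<in> {0<..<d'}. barrier_value M F X d' r' q' x = payoff q' x}"
    using a assms by simp
  then show ?thesis
    unfolding region' by simp
qed

end


section \<open>Monotonicity of the optimal level\<close>

theorem proposition4p4:
  fixes M :: "'w measure" and F :: "ennreal \<Rightarrow> 'w measure"
    and B :: "real \<Rightarrow> 'w \<Rightarrow> real"
    and \<mu> \<sigma> :: "real \<Rightarrow> real"
    and X :: "real \<Rightarrow> real \<Rightarrow> 'w \<Rightarrow> real"
    and \<psi> \<phi> :: "real \<Rightarrow> real \<Rightarrow> real"
    and P :: "(real \<times> real \<times> real) set"
    and x\<^sub>0 :: "real \<Rightarrow> real \<Rightarrow> real \<Rightarrow> real"
  assumes model: "diffusion_model M F B \<mu> \<sigma> X"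
    and params: "\<And>d r q. (d, r, q) \<in> P \<Longrightarrow> 0 < r \<and> 0 < q \<and> q < d"
    and theta: "\<And>d r q. (d, r, q) \<in> P \<Longrightarrow> mono_on {0<..} (\<lambda>x. r * x - \<mu> x)"
    and psi: "\<And>d r q. (d, r, q) \<in> P \<Longrightarrow> increasing_fundamental_solution M \<mu> \<sigma> X r (\<psi> r)"
    and phi: "\<And>d r q. (d, r, q) \<in> P \<Longrightarrow> decreasing_fundamental_solution M \<mu> \<sigma> X r (\<phi> r)"
    and phi_convex: "\<And>d r q. (d, r, q) \<in> P \<Longrightarrow> convex_on {0<..} (\<phi> r)"
    and level: "\<And>d r q. (d, r, q) \<in> P \<Longrightarrow>
      optimal_price_level M F X (\<psi> r) (\<phi> r) d r q (x\<^sub>0 d r q)"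
  shows "(\<forall>r q. antimono_on {d. (d, r, q) \<in> P} (\<lambda>d. x\<^sub>0 d r q)) \<and>
         (\<forall>d q. mono_on {r. (d, r, q) \<in> P} (\<lambda>r. x\<^sub>0 d r q)) \<and>
         (\<forall>d r. mono_on {q. (d, r, q) \<in> P} (\<lambda>q. x\<^sub>0 d r q))"
proof -
  have mono: "x\<^sub>0 d r q \<le> x\<^sub>0 d' r' q'"
    if "(d, r, q) \<in> P" "(d', r', q') \<in> P" "d' \<le> d" "r \<le> r'" "q \<le> q'" for d r q d' r' q'
    using diffusion_model.optimal_price_level_mono[OF model level[OF that(1)] level[OF that(2)]]
      that params[OF that(1)] params[OF that(2)] by simp
  show ?thesis
    by (intro conjI allI monotone_onI) (auto intro: mono)
qed

end
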